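(* Let $G$ be a $\{K_{1,3},N\}$-$o$-heavy graph. Then $\mathrm{cl}_c(G)$ is claw-free and $N$-$p$-heavy.
   Context: All graphs are finite and simple. For a graph $G$ with $n=|V(G)|$ vertices, $d(v)$ and $N(v)$ denote the degree and neighborhood of $v$ in $G$. A vertex $v$ is heavy in $G$ if $d(v)\ge n/2$. A pair $\{u,v\}$ of nonadjacent vertices is an $o$-heavy pair of $G$ if $d(u)+d(v)\ge n$; a pair $\{u,v\}$ of adjacent vertices is an $a$-heavy pair of $G$ if $d(u)+d(v)\ge n$. For a graph $H$, $G$ is $H$-$o$-heavy if every induced subgraph of $G$ isomorphic to $H$ contains an $o$-heavy pair of $G$; for a family of graphs, $G$ is $\mathcal{H}$-$o$-heavy if it is $H$-$o$-heavy for each $H$ in it. The claw is $K_{1,3}$; claw-$o$-heavy means $K_{1,3}$-$o$-heavy. $c$-closure (Čada): let $G$ be claw-$o$-heavy on $n$ vertices and $x\in V(G)$. Let $E^{BC}_x=\{uv: u,v\in N(x), uv\notin E(G), d(u)+d(v)\ge n\}$ and $G^{BC}_x=(V(G),E(G)\cup E^{BC}_x)$. The vertex $x$ is $c$-eligible if $N(x)$ is not a clique in $G^{BC}_x$ and either (i) $G^{BC}_x[N(x)]$ is connected, or (ii) $G^{BC}_x[N(x)]$ is the disjoint union of two cliques $C_1,C_2$ and there is a vertex $z$ such that $\{x,z\}$ is an $o$-heavy pair of $G$ and $zy_1,zy_2\in E(G)$ for some $y_1\in C_1$, $y_2\in C_2$. The local $c$-completion $G^o_x$ is obtained from $G$ by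 adding all edges $uv$ with $u,v\in N(x)$, $uv\notin E(G)$. The $c$-closure $\mathrm{cl}_c(G)$ is the graph obtained by recursively performing local $c$-completions at $c$-eligible vertices until no $c$-eligible vertex remains (each intermediate graph is claw-$o$-heavy, and the result is uniquely determined). The net $N$ is the graph with vertices $a_1,a_2,a_3,b_1,b_2,b_3$ and edges $a_1a_2,a_2a_3,a_1a_3,a_1b_1,a_2b_2,a_3b_3$. An induced net of $G$ (labelled this way) is $p$-heavy if its triangle $\{a_1,a_2,a_3\}$ contains an $a$-heavy pair of $G$. $G$ is $N$-$p$-heavy if every induced net of $G$ is $p$-heavy.
   Formalization: In the definition of c-eligible, N(x) is required not to be a clique in G, instead of not a clique in G^{BC}_x; with the latter wording K_{3,3} would be its own c-closure although it contains induced claws. *)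

theory Defs
  imports "Graph_Theory.Digraph_Component" "Graph_Theory.Digraph_Isomorphism"
begin

text \<open>
  A finite simple graph is a \<^locale>\<open>pair_graph\<close>: a finite, symmetric, loop-free set of pairs,
  each undirected edge being represented by its two orientations.
\<close>

type_synonym 'a ugraph = "'a pair_pre_digraph"

definition neighborhood :: "'a ugraph \<Rightarrow> 'a \<Rightarrow> 'a set" where
  "neighborhood G v = {u. (v, u) \<in> parcs G}"

definition degree :: "'a ugraph \<Rightarrow> 'a \<Rightarrow> nat" where
  "degree G v = card (neighborhood G v)"

definition is_clique :: "'a ugraph \<Rightarrow> 'a set \<Rightarrow> bool" where
  "is_clique G S \<longleftrightarrow> S \<subseteq> pverts G \<and> (\<forall>u\<in>S. \<forall>v\<in>S. u \<noteq> v \<longrightarrow> (u, v) \<in> parcs G)"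

definition o_heavy_pair :: "'a ugraph \<Rightarrow> 'a \<Rightarrow> 'a \<Rightarrow> bool" where
  "o_heavy_pair G u v \<longleftrightarrow> u \<in> pverts G \<and> v \<in> pverts G \<and> u \<noteq> v \<and> (u, v) \<notin> parcs G
     \<and> degree G u + degree G v \<ge> card (pverts G)"

definition a_heavy_pair :: "'a ugraph \<Rightarrow> 'a \<Rightarrow> 'a \<Rightarrow> bool" where
  "a_heavy_pair G u v \<longleftrightarrow> (u, v) \<in> parcs G \<and> degree G u + degree G v \<ge> card (pverts G)"

definition H_o_heavy :: "'h ugraph \<Rightarrow> 'a ugraph \<Rightarrow> bool" where
  "H_o_heavy H G \<longleftrightarrow>
     (\<forall>S \<subseteq> pverts G. digraph_iso (with_proj G \<restriction> S) (with_proj H) \<longrightarrow>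
        (\<exists>u\<in>S. \<exists>v\<in>S. o_heavy_pair G u v))"

definition family_o_heavy :: "'h ugraph set \<Rightarrow> 'a ugraph \<Rightarrow> bool" where
  "family_o_heavy \<H> G \<longleftrightarrow> (\<forall>H\<in>\<H>. H_o_heavy H G)"

definition H_free :: "'h ugraph \<Rightarrow> 'a ugraph \<Rightarrow> bool" where
  "H_free H G \<longleftrightarrow> \<not> (\<exists>S \<subseteq> pverts G. digraph_iso (with_proj G \<restriction> S) (with_proj H))"

definition claw :: "nat ugraph" where
  "claw = \<lparr> pverts = {0, 1, 2, 3},
            parcs = {(0, 1), (0, 2), (0, 3)} \<union> {(1, 0), (2, 0), (3, 0)} \<rparr>"

definition net_on :: "'a \<Rightarrow> 'a \<Rightarrow> 'a \<Rightarrow> 'a \<Rightarrow> 'a \<Rightarrow> 'a \<Rightarrow> 'a ugraph" where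
  "net_on a1 a2 a3 b1 b2 b3 =
     \<lparr> pverts = {a1, a2, a3, b1, b2, b3},
       parcs = {(a1, a2), (a2, a3), (a1, a3), (a1, b1), (a2, b2), (a3, b3)}
             \<union> {(a2, a1), (a3, a2), (a3, a1), (b1, a1), (b2, a2), (b3, a3)} \<rparr>"

definition net :: "nat ugraph" where
  "net = net_on 0 1 2 3 4 5"

definition N_p_heavy :: "'a ugraph \<Rightarrow> bool" where
  "N_p_heavy G \<longleftrightarrow>
     (\<forall>a1 a2 a3 b1 b2 b3.
        distinct [a1, a2, a3, b1, b2, b3]
        \<and> induced_subgraph (with_proj (net_on a1 a2 a3 b1 b2 b3)) (with_proj G) \<longrightarrow>
        (\<exists>u\<in>{a1, a2, a3}. \<exists>v\<in>{a1, a2, a3}. a_heavy_pair G u v))"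

definition BC_completion :: "'a ugraph \<Rightarrow> 'a \<Rightarrow> 'a ugraph" where
  "BC_completion G x =
     G\<lparr>parcs := parcs G \<union>
       {(u, v). u \<in> neighborhood G x \<and> v \<in> neighborhood G x \<and> o_heavy_pair G u v}\<rparr>"

definition disjoint_cliques :: "'a ugraph \<Rightarrow> 'a set \<Rightarrow> 'a set \<Rightarrow> bool" where
  "disjoint_cliques G C1 C2 \<longleftrightarrow> is_clique G C1 \<and> is_clique G C2 \<and> C1 \<inter> C2 = {}
     \<and> (\<forall>u\<in>C1. \<forall>v\<in>C2. (u, v) \<notin> parcs G)"

text \<open>
  The neighborhood of \<open>x\<close> is required not to be a clique in \<open>G\<close> itself, not merely in
  \<open>BC_completion G x\<close>.  With the latter condition no vertex of \<open>K\<^bsub>3,3\<^esub>\<close> would be eligible (any two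
  vertices on the same side form an o-heavy pair), so \<open>K\<^bsub>3,3\<^esub>\<close>, which contains induced claws, would
  be its own closure.
\<close>

definition c_eligible :: "'a ugraph \<Rightarrow> 'a \<Rightarrow> bool" where
  "c_eligible G x \<longleftrightarrow> x \<in> pverts G \<and> \<not> is_clique G (neighborhood G x) \<and>
     (Digraph_Component.connected (with_proj (BC_completion G x) \<restriction> neighborhood G x) \<or>
      (\<exists>C1 C2. neighborhood G x = C1 \<union> C2 \<and> disjoint_cliques (BC_completion G x) C1 C2 \<and>
         (\<exists>z. o_heavy_pair G x z \<and> (\<exists>y1\<in>C1. (z, y1) \<in> parcs G) \<and> (\<exists>y2\<in>C2. (z, y2) \<in> parcs G))))"

definition local_completion :: "'a ugraph \<Rightarrow> 'a \<Rightarrow> 'a ugraph" where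
  "local_completion G x =
     G\<lparr>parcs := parcs G \<union>
       {(u, v). u \<in> neighborhood G x \<and> v \<in> neighborhood G x \<and> u \<noteq> v}\<rparr>"

definition c_step :: "'a ugraph \<Rightarrow> 'a ugraph \<Rightarrow> bool" where
  "c_step G H \<longleftrightarrow> (\<exists>x. c_eligible G x \<and> H = local_completion G x)"

text \<open>
  \<open>is_c_closure G H\<close>: the graph \<open>H\<close> results from \<open>G\<close> by a maximal sequence of local completions at
  eligible vertices, in some order.  For claw-o-heavy \<open>G\<close> the order is known to be immaterial, and
  \<open>H\<close> is the c-closure of \<open>G\<close>.
\<close>

definition is_c_closure :: "'a ugraph \<Rightarrow> 'a ugraph \<Rightarrow> bool" where
  "is_c_closure G H \<longleftrightarrow> c_step\<^sup>*\<^sup>* G H \<and> \<not> (\<exists>x. c_eligible H x)"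

lemma pair_graph_iff:
  "pair_graph G \<longleftrightarrow> finite (pverts G) \<and> parcs G \<subseteq> pverts G \<times> pverts G
     \<and> sym (parcs G) \<and> irrefl (parcs G)"
proof
  assume "pair_graph G"
  then interpret pair_graph G .
  show "finite (pverts G) \<and> parcs G \<subseteq> pverts G \<times> pverts G \<and> sym (parcs G) \<and> irrefl (parcs G)"
  proof (intro conjI)
    show "finite (pverts G)" by (rule pair_finite_verts)
    show "parcs G \<subseteq> pverts G \<times> pverts G" using in_arcsD1 in_arcsD2 by auto
    show "sym (parcs G)" using pair_sym_arcs by (simp add: symmetric_def)
    show "irrefl (parcs G)" using pair_no_loops by (fastforce simp: irrefl_def)
  qed
next
  assume *: "finite (pverts G) \<and> parcs G \<subseteq> pverts G \<times> pverts G \<and> sym (parcs G) \<and> irrefl (parcs G)"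
  then have "finite (parcs G)" by (meson finite_SigmaI finite_subset)
  with * show "pair_graph G"
    by unfold_locales (auto simp: symmetric_def irrefl_def)
qed

lemma pair_graph_local_completion:
  assumes "pair_graph G" shows "pair_graph (local_completion G x)"
  using assms unfolding pair_graph_iff
  by (auto simp: local_completion_def neighborhood_def sym_def irrefl_def)

lemma parcs_local_completion_psubset:
  assumes "pair_graph G" and "c_eligible G x"
  shows "parcs G \<subset> parcs (local_completion G x)"
proof -
  have "neighborhood G x \<subseteq> pverts G"
    using assms(1) by (auto simp: pair_graph_iff neighborhood_def)
  then obtain u v where "u \<in> neighborhood G x" "v \<in> neighborhood G x" "u \<noteq> v" "(u, v) \<notin> parcs G"
    using assms(2) unfolding c_eligible_def is_clique_def by blast
  then show ?thesis unfolding local_completion_def by auto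
qed

lemma is_c_closure_exists:
  assumes "pair_graph G" shows "\<exists>H. is_c_closure G H"
  using assms
proof (induction "card (pverts G \<times> pverts G - parcs G)" arbitrary: G rule: less_induct)
  case less
  show ?case
  proof (cases "\<exists>x. c_eligible G x")
    case False
    then show ?thesis unfolding is_c_closure_def by blast
  next
    case True
    then obtain x where x: "c_eligible G x" by blast
    let ?G = "local_completion G x"
    have g: "pair_graph ?G" using less.prems by (rule pair_graph_local_completion)
    have v: "pverts ?G = pverts G" by (simp add: local_completion_def)
    have "pverts G \<times> pverts G - parcs ?G \<subset> pverts G \<times> pverts G - parcs G"
      using parcs_local_completion_psubset[OF less.prems x] g v
      unfolding pair_graph_iff by blast
    then have "card (pverts ?G \<times> pverts ?G - parcs ?G) < card (pverts G \<times> pverts G - parcs G)"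
      using less.prems v by (metis finite_Diff finite_SigmaI pair_graph_iff psubset_card_mono)
    then obtain H where "is_c_closure ?G H" using less.hyps g by blast
    moreover have "c_step G ?G" using x unfolding c_step_def by blast
    ultimately show ?thesis
      unfolding is_c_closure_def by (meson converse_rtranclp_into_rtranclp)
  qed
qed

end

theory Submission
  imports Defs
begin

text \<open>
  Call two vertices light if their degree sum is less than the number \<open>n\<close> of vertices, a claw light
  if its leaves are pairwise light, and a net light if all its pairs except the three pendant edges
  are light.  Local completion at \<open>x\<close> (eligible or not) creates no light claw, and it creates no
  light net in a graph without light claws: after the completion every neighbour of \<open>x\<close> has at
  least the old degree of \<open>x\<close>, so a light claw or net using new edges can be rerouted through \<open>x\<close>.

  A graph without light claws and without eligible vertices has no o-heavy pair.  Indeed, let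
  \<open>u\<close>, \<open>v\<close> be o-heavy.  They have more common neighbours than there are vertices outside
  \<open>N[u] \<union> N[v]\<close>, and each common neighbour has a neighbour there, in the clique of its
  neighbourhood that avoids \<open>u\<close> and \<open>v\<close>.  So two common neighbours \<open>x\<close>, \<open>y\<close> share such a
  neighbour \<open>z\<close>, and they are nonadjacent.  If \<open>x\<close>, \<open>y\<close> lie in different cliques of \<open>N(u)\<close> then
  \<open>u\<close> is eligible because of \<open>v\<close>; otherwise \<open>x\<close>, \<open>y\<close> are o-heavy and \<open>x\<close> is eligible because
  of \<open>y\<close>.  Without o-heavy pairs every claw is light, and so is every net that is not p-heavy.
\<close>

section \<open>Light pairs, claws and nets\<close>

definition light :: "'a ugraph \<Rightarrow> 'a \<Rightarrow> 'a \<Rightarrow> bool" where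
  "light G u v \<longleftrightarrow> degree G u + degree G v < card (pverts G)"

definition claw_at :: "'a ugraph \<Rightarrow> 'a \<Rightarrow> 'a \<Rightarrow> 'a \<Rightarrow> 'a \<Rightarrow> bool" where
  "claw_at G c y1 y2 y3 \<longleftrightarrow> distinct [c, y1, y2, y3]
     \<and> (c, y1) \<in> parcs G \<and> (c, y2) \<in> parcs G \<and> (c, y3) \<in> parcs G
     \<and> (y1, y2) \<notin> parcs G \<and> (y1, y3) \<notin> parcs G \<and> (y2, y3) \<notin> parcs G"

definition light_claw :: "'a ugraph \<Rightarrow> 'a \<Rightarrow> 'a \<Rightarrow> 'a \<Rightarrow> 'a \<Rightarrow> bool" where
  "light_claw G c y1 y2 y3 \<longleftrightarrow> claw_at G c y1 y2 y3
     \<and> light G y1 y2 \<and> light G y1 y3 \<and> light G y2 y3"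

definition net_at :: "'a ugraph \<Rightarrow> 'a \<Rightarrow> 'a \<Rightarrow> 'a \<Rightarrow> 'a \<Rightarrow> 'a \<Rightarrow> 'a \<Rightarrow> bool" where
  "net_at G a1 a2 a3 b1 b2 b3 \<longleftrightarrow> distinct [a1, a2, a3, b1, b2, b3]
     \<and> (a1, a2) \<in> parcs G \<and> (a1, a3) \<in> parcs G \<and> (a2, a3) \<in> parcs G
     \<and> (a1, b1) \<in> parcs G \<and> (a2, b2) \<in> parcs G \<and> (a3, b3) \<in> parcs G
     \<and> (a1, b2) \<notin> parcs G \<and> (a1, b3) \<notin> parcs G \<and> (a2, b1) \<notin> parcs G
     \<and> (a2, b3) \<notin> parcs G \<and> (a3, b1) \<notin> parcs G \<and> (a3, b2) \<notin> parcs G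
     \<and> (b1, b2) \<notin> parcs G \<and> (b1, b3) \<notin> parcs G \<and> (b2, b3) \<notin> parcs G"

text \<open>Lightness ignores adjacency, so that it can also be required of the triangle pairs,
  where it says that none of them is a-heavy. This is what lets a net whose triangle edges are new
  be turned into a light claw or another light net.\<close>

definition light_net :: "'a ugraph \<Rightarrow> 'a \<Rightarrow> 'a \<Rightarrow> 'a \<Rightarrow> 'a \<Rightarrow> 'a \<Rightarrow> 'a \<Rightarrow> bool" where
  "light_net G a1 a2 a3 b1 b2 b3 \<longleftrightarrow> net_at G a1 a2 a3 b1 b2 b3
     \<and> light G a1 a2 \<and> light G a1 a3 \<and> light G a2 a3
     \<and> light G a1 b2 \<and> light G a1 b3 \<and> light G a2 b1
     \<and> light G a2 b3 \<and> light G a3 b1 \<and> light G a3 b2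
     \<and> light G b1 b2 \<and> light G b1 b3 \<and> light G b2 b3"

lemma light_commute: "light G u v \<longleftrightarrow> light G v u"
  by (auto simp: light_def add.commute)

lemma pair_graph_arcs_sym: "pair_graph G \<Longrightarrow> (u, v) \<in> parcs G \<longleftrightarrow> (v, u) \<in> parcs G"
  by (auto simp: pair_graph_iff sym_def)

lemma pair_graph_no_loop: "pair_graph G \<Longrightarrow> (u, u) \<notin> parcs G"
  by (auto simp: pair_graph_iff irrefl_def)

lemma pair_graph_arcs_verts: "pair_graph G \<Longrightarrow> (u, v) \<in> parcs G \<Longrightarrow> u \<in> pverts G \<and> v \<in> pverts G"
  by (auto simp: pair_graph_iff)

lemma finite_neighborhood: "pair_graph G \<Longrightarrow> finite (neighborhood G v)"
  unfolding pair_graph_iff neighborhood_def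
  by (rule finite_subset[of _ "pverts G"]) auto

text \<open>Rotation allows the leaf at a new edge to be taken as the first one;
  \<open>light_net_rotate\<close> does the same for nets.\<close>

lemma light_claw_rotate:
  assumes "pair_graph G" and "light_claw G c y1 y2 y3"
  shows "light_claw G c y2 y3 y1"
  using assms(2) pair_graph_arcs_sym[OF assms(1), of _ y1]
  unfolding light_claw_def claw_at_def by (auto simp: light_commute[of _ _ y1])

lemma light_net_rotate:
  assumes "pair_graph G" and "light_net G a1 a2 a3 b1 b2 b3"
  shows "light_net G a2 a3 a1 b2 b3 b1"
  using assms(2) pair_graph_arcs_sym[OF assms(1)] light_commute[of G]
  unfolding light_net_def net_at_def by (simp add: eq_commute)

section \<open>Local completion\<close>

lemma parcs_local_completion:
  "(u, v) \<in> parcs (local_completion G x) \<longleftrightarrow>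
     (u, v) \<in> parcs G \<or> ((x, u) \<in> parcs G \<and> (x, v) \<in> parcs G \<and> u \<noteq> v)"
  by (auto simp: local_completion_def neighborhood_def)

lemma pverts_local_completion [simp]: "pverts (local_completion G x) = pverts G"
  by (simp add: local_completion_def)

text \<open>Degrees can only grow while the number of vertices stays fixed, so lightness passes back
  to \<open>G\<close>.\<close>

lemma light_local_completion:
  assumes "pair_graph G" and "light (local_completion G x) u v"
  shows "light G u v"
proof -
  have "degree G w \<le> degree (local_completion G x) w" for w
    unfolding degree_def
    using finite_neighborhood[OF pair_graph_local_completion[OF assms(1)]]
    by (rule card_mono) (auto simp: neighborhood_def parcs_local_completion)
  from this[of u] this[of v] assms(2) show ?thesis by (simp add: light_def)
qed

text \<open>After the completion \<open>u\<close> is adjacent to \<open>x\<close> and to all other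
  neighbours of \<open>x\<close>, so its new degree is at least the old degree of \<open>x\<close>.
  Hence \<open>x\<close> may take the place of \<open>u\<close> in light pairs.\<close>

lemma light_center_local_completion:
  assumes G: "pair_graph G" and "(x, u) \<in> parcs G" and "light (local_completion G x) u v"
  shows "light G x v"
proof -
  let ?G = "local_completion G x"
  note fin = finite_neighborhood[OF pair_graph_local_completion[OF G]]
  have "x \<notin> neighborhood G x" "u \<in> neighborhood G x"
    using assms pair_graph_no_loop[OF G] by (auto simp: neighborhood_def)
  \<comment> \<open>Trading \<open>u\<close> for \<open>x\<close> in the neighbourhood of
    \<open>x\<close> keeps its size and gives a set of new neighbours of \<open>u\<close>.\<close>
  then have "degree G x = card (insert x (neighborhood G x - {u}))"
    using finite_neighborhood[OF G, of x]
    by (simp add: degree_def card.insert_remove card_Suc_Diff1 del: card_Diff_insert)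
  also have "\<dots> \<le> degree ?G u"
    unfolding degree_def using fin
    by (rule card_mono)
       (use assms(2) pair_graph_arcs_sym[OF G] in \<open>auto simp: neighborhood_def parcs_local_completion\<close>)
  finally have "degree G x \<le> degree ?G u" .
  moreover have "degree G v \<le> degree ?G v"
    unfolding degree_def using fin
    by (rule card_mono) (auto simp: neighborhood_def parcs_local_completion)
  ultimately show ?thesis using assms(3) by (simp add: light_def)
qed

section \<open>Tracing new edges of a completion back to the old graph\<close>

lemma local_completion_mono: "(u, v) \<in> parcs G \<Longrightarrow> (u, v) \<in> parcs (local_completion G x)"
  by (simp add: parcs_local_completion)

lemma local_completion_new_edge:
  "(u, v) \<in> parcs (local_completion G x) \<Longrightarrow> (u, v) \<notin> parcs G \<Longrightarrow>
    (x, u) \<in> parcs G \<and> (x, v) \<in> parcs G"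
  by (simp add: parcs_local_completion)

lemma local_completion_old_edge:
  "(x, u) \<notin> parcs G \<or> (x, v) \<notin> parcs G \<Longrightarrow>
    (u, v) \<in> parcs (local_completion G x) \<longleftrightarrow> (u, v) \<in> parcs G"
  by (auto simp: parcs_local_completion)

text \<open>The closed neighbourhood of \<open>x\<close> becomes a clique containing
  \<open>u\<close>, so a vertex that stays nonadjacent to \<open>u\<close> lies outside it.\<close>

lemma local_completion_nonadjacent:
  assumes "pair_graph G" and "(x, u) \<in> parcs G" and "(u, v) \<notin> parcs (local_completion G x)"
    and "u \<noteq> v"
  shows "(x, v) \<notin> parcs G" and "(v, x) \<notin> parcs G" and "v \<noteq> x" and "x \<noteq> v"
  using assms pair_graph_arcs_sym[OF assms(1)] by (auto simp: parcs_local_completion)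

text \<open>The leaf \<open>y1\<close> is replaced by \<open>x\<close>. The leaves
  \<open>y2\<close>, \<open>y3\<close> are not adjacent to \<open>y1\<close>, hence lie outside the
  closed neighbourhood of \<open>x\<close>; so their edges to \<open>c\<close> are old and
  \<open>x\<close> is adjacent to neither.\<close>

lemma light_claw_new_edge:
  assumes G: "pair_graph G" and L: "light_claw (local_completion G x) c y1 y2 y3"
    and c: "(x, c) \<in> parcs G" and y1: "(x, y1) \<in> parcs G"
  shows "light_claw G c x y2 y3"
proof -
  note L' = L[unfolded light_claw_def claw_at_def]
  note out = local_completion_nonadjacent[OF G y1]
  have "(y1, y2) \<notin> parcs (local_completion G x)" "y1 \<noteq> y2"
    "(y1, y3) \<notin> parcs (local_completion G x)" "y1 \<noteq> y3"
    using L' by auto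
  note out = out[OF this(1,2)] out[OF this(3,4)]
  have "light G x y2" "light G x y3" "light G y2 y3"
    using L' light_center_local_completion[OF G y1] light_local_completion[OF G] by blast+
  moreover have "(c, x) \<in> parcs G" "c \<noteq> x"
    using c pair_graph_arcs_sym[OF G] pair_graph_no_loop[OF G] by auto
  ultimately show ?thesis
    using L' out by (simp add: light_claw_def claw_at_def local_completion_old_edge)
qed

lemma light_claw_local_completion:
  assumes G: "pair_graph G" and L: "light_claw (local_completion G x) c y1 y2 y3"
  shows "\<exists>c y1 y2 y3. light_claw G c y1 y2 y3"
proof (cases "(c, y1) \<in> parcs G \<and> (c, y2) \<in> parcs G \<and> (c, y3) \<in> parcs G")
  case True
  then have "light_claw G c y1 y2 y3"
    using L unfolding light_claw_def claw_at_def
    by (auto intro: light_local_completion[OF G] dest: local_completion_mono[of _ _ G x])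
  then show ?thesis by blast
next
  case False
  have "(c, y1) \<in> parcs (local_completion G x)" "(c, y2) \<in> parcs (local_completion G x)"
    "(c, y3) \<in> parcs (local_completion G x)"
    using L by (simp_all add: light_claw_def claw_at_def)
  with False consider "(x, c) \<in> parcs G" "(x, y1) \<in> parcs G"
    | "(x, c) \<in> parcs G" "(x, y2) \<in> parcs G" | "(x, c) \<in> parcs G" "(x, y3) \<in> parcs G"
    using local_completion_new_edge by metis
  note cases = this
  note rotate = light_claw_rotate[OF pair_graph_local_completion[OF G]]
  note L' = rotate[OF L]
  note L'' = rotate[OF L']
  from cases show ?thesis
    using light_claw_new_edge[OF G L] light_claw_new_edge[OF G L'] light_claw_new_edge[OF G L'']
    by cases blast+
qed

text \<open>The pendant vertex \<open>b1\<close> is replaced by \<open>x\<close>. The other four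
  vertices besides \<open>a1\<close> are not adjacent to \<open>b1\<close>, hence lie outside the
  closed neighbourhood of \<open>x\<close>, and all edges at them are old.\<close>

lemma light_net_new_pendant_edge:
  assumes G: "pair_graph G" and L: "light_net (local_completion G x) a1 a2 a3 b1 b2 b3"
    and a1: "(x, a1) \<in> parcs G" and b1: "(x, b1) \<in> parcs G"
  shows "light_net G a1 a2 a3 x b2 b3"
proof -
  note L' = L[unfolded light_net_def net_at_def]
  have far: "(b1, w) \<notin> parcs (local_completion G x) \<and> b1 \<noteq> w \<and> light (local_completion G x) b1 w"
    if "w \<in> {a2, a3, b2, b3}" for w
    using L' that pair_graph_arcs_sym[OF pair_graph_local_completion[OF G], of b1]
    by (auto simp: light_commute[of _ _ b1])
  have out: "(x, w) \<notin> parcs G" "(w, x) \<notin> parcs G" "w \<noteq> x" "x \<noteq> w" "light G x w" "light G w x"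
    if "w \<in> {a2, a3, b2, b3}" for w
    using far[OF that] local_completion_nonadjacent[OF G b1]
      light_center_local_completion[OF G b1] light_commute by metis+
  note out = out[of a2, simplified] out[of a3, simplified] out[of b2, simplified] out[of b3, simplified]
  have "(a1, x) \<in> parcs G" "a1 \<noteq> x"
    using a1 pair_graph_arcs_sym[OF G] pair_graph_no_loop[OF G] by auto
  moreover have "light G a1 a2" "light G a1 a3" "light G a2 a3" "light G a1 b2" "light G a1 b3"
    "light G a2 b3" "light G a3 b2" "light G b2 b3"
    using L' light_local_completion[OF G] by blast+
  ultimately show ?thesis
    using L' out by (simp add: light_net_def net_at_def local_completion_old_edge)
qed

text \<open>Without the edge between \<open>a1\<close> and \<open>a2\<close>, the corner
  \<open>a3\<close> is the centre of a claw; its leaf pair \<open>a1\<close>, \<open>a2\<close> is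
  light because it came from the triangle.\<close>

lemma light_net_one_new_triangle_edge:
  assumes G: "pair_graph G" and L: "light_net (local_completion G x) a1 a2 a3 b1 b2 b3"
    and "(a3, b3) \<in> parcs G" "(a1, a2) \<notin> parcs G" "(a1, a3) \<in> parcs G" "(a2, a3) \<in> parcs G"
  shows "light_claw G a3 a1 a2 b3"
proof -
  note L' = L[unfolded light_net_def net_at_def]
  have "(a1, b3) \<notin> parcs G" "(a2, b3) \<notin> parcs G"
    using L' local_completion_mono[of _ _ G x] by blast+
  moreover have "light G a1 a2" "light G a1 b3" "light G a2 b3"
    using L' light_local_completion[OF G] by blast+
  moreover have "(a3, a1) \<in> parcs G" "(a3, a2) \<in> parcs G"
    using assms(5,6) pair_graph_arcs_sym[OF G] by auto
  moreover have "distinct [a3, a1, a2, b3]" using L' by auto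
  ultimately show ?thesis
    using assms(3,4) by (simp add: light_claw_def claw_at_def)
qed

text \<open>All three corners are neighbours of \<open>x\<close>, and \<open>b1\<close>,
  \<open>b2\<close> are not, since they are not adjacent to \<open>a3\<close>. So \<open>x\<close>
  takes over the corner \<open>a3\<close>, which becomes the pendant vertex at \<open>x\<close>.
  Pairs with \<open>x\<close> are light because the corresponding pairs with \<open>a3\<close>
  were.\<close>

lemma light_net_two_new_triangle_edges:
  assumes G: "pair_graph G" and L: "light_net (local_completion G x) a1 a2 a3 b1 b2 b3"
    and "(a1, b1) \<in> parcs G" "(a2, b2) \<in> parcs G"
    and "(a1, a2) \<in> parcs G" "(a1, a3) \<notin> parcs G" "(a2, a3) \<notin> parcs G"
  shows "light_net G x a1 a2 a3 b1 b2"
proof -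
  note L' = L[unfolded light_net_def net_at_def]
  note sym = pair_graph_arcs_sym[OF G]
  have a: "(x, a1) \<in> parcs G" "(x, a2) \<in> parcs G" "(x, a3) \<in> parcs G"
    using L' assms(6,7) local_completion_new_edge[of _ _ G x] by blast+
  have "(a3, b1) \<notin> parcs (local_completion G x)" "a3 \<noteq> b1"
    "(a3, b2) \<notin> parcs (local_completion G x)" "a3 \<noteq> b2"
    using L' by auto
  note b = local_completion_nonadjacent[OF G a(3) this(1,2)]
    local_completion_nonadjacent[OF G a(3) this(3,4)]
  have "(a1, b2) \<notin> parcs G" "(a2, b1) \<notin> parcs G" "(a3, b1) \<notin> parcs G" "(a3, b2) \<notin> parcs G"
    "(b1, b2) \<notin> parcs G"
    using L' local_completion_mono[of _ _ G x] by blast+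
  moreover have "x \<noteq> a1" "x \<noteq> a2" "x \<noteq> a3"
    using a pair_graph_no_loop[OF G] by auto
  moreover have "light (local_completion G x) a3 a1" "light (local_completion G x) a3 a2"
    "light (local_completion G x) a3 b1" "light (local_completion G x) a3 b2"
    using L' by (simp_all add: light_commute[of _ a3])
  then have "light G x a1" "light G x a2" "light G x b1" "light G x b2"
    using light_center_local_completion[OF G a(3)] by blast+
  moreover have "light G a1 a2" "light G a1 a3" "light G a2 a3" "light G a1 b2" "light G a2 b1"
    "light G a3 b1" "light G a3 b2" "light G b1 b2"
    using L' light_local_completion[OF G] by blast+
  ultimately show ?thesis
    using L' assms(3-) a b sym[of b1 a3] sym[of b2 a3]
    by (simp add: light_net_def net_at_def light_commute[of _ _ a3])
qed

text \<open>The corners are pairwise nonadjacent old neighbours of \<open>x\<close>.\<close>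

lemma light_net_three_new_triangle_edges:
  assumes G: "pair_graph G" and L: "light_net (local_completion G x) a1 a2 a3 b1 b2 b3"
    and "(a1, a2) \<notin> parcs G" "(a1, a3) \<notin> parcs G" "(a2, a3) \<notin> parcs G"
  shows "light_claw G x a1 a2 a3"
proof -
  note L' = L[unfolded light_net_def net_at_def]
  have a: "(x, a1) \<in> parcs G" "(x, a2) \<in> parcs G" "(x, a3) \<in> parcs G"
    using L' assms(3-) local_completion_new_edge[of _ _ G x] by blast+
  moreover have "x \<noteq> a1" "x \<noteq> a2" "x \<noteq> a3"
    using a pair_graph_no_loop[OF G] by auto
  moreover have "light G a1 a2" "light G a1 a3" "light G a2 a3"
    using L' light_local_completion[OF G] by blast+
  ultimately show ?thesis
    using L' assms(3-) by (simp add: light_claw_def claw_at_def)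
qed

lemma light_net_local_completion:
  assumes G: "pair_graph G" and L: "light_net (local_completion G x) a1 a2 a3 b1 b2 b3"
  shows "(\<exists>c y1 y2 y3. light_claw G c y1 y2 y3) \<or>
         (\<exists>a1 a2 a3 b1 b2 b3. light_net G a1 a2 a3 b1 b2 b3)"
proof (cases "(a1, b1) \<in> parcs G \<and> (a2, b2) \<in> parcs G \<and> (a3, b3) \<in> parcs G")
  case False
  have "(a1, b1) \<in> parcs (local_completion G x)" "(a2, b2) \<in> parcs (local_completion G x)"
    "(a3, b3) \<in> parcs (local_completion G x)"
    using L by (simp_all add: light_net_def net_at_def)
  with False consider "(x, a1) \<in> parcs G" "(x, b1) \<in> parcs G"
    | "(x, a2) \<in> parcs G" "(x, b2) \<in> parcs G" | "(x, a3) \<in> parcs G" "(x, b3) \<in> parcs G"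
    using local_completion_new_edge by metis
  note cases = this
  note rotate = light_net_rotate[OF pair_graph_local_completion[OF G]]
  note L' = rotate[OF L]
  note L'' = rotate[OF L']
  from cases show ?thesis
    using light_net_new_pendant_edge[OF G L] light_net_new_pendant_edge[OF G L']
      light_net_new_pendant_edge[OF G L'']
    by cases blast+
next
  case True
  note rotate = light_net_rotate[OF pair_graph_local_completion[OF G]]
  note L' = rotate[OF L]
  note L'' = rotate[OF L']
  note sym = pair_graph_arcs_sym[OF G]
  \<comment> \<open>With all pendant edges old, the cases are ordered by the number of new triangle
    edges: none keeps the net, one gives a claw at the opposite corner, two give a net through
    \<open>x\<close>, three give a claw at \<open>x\<close>. Rotations cover the choice of
    edges.\<close>
  consider "(a1, a2) \<in> parcs G" "(a1, a3) \<in> parcs G" "(a2, a3) \<in> parcs G"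
    | "(a1, a2) \<notin> parcs G" "(a1, a3) \<in> parcs G" "(a2, a3) \<in> parcs G"
    | "(a1, a2) \<in> parcs G" "(a1, a3) \<notin> parcs G" "(a2, a3) \<in> parcs G"
    | "(a1, a2) \<in> parcs G" "(a1, a3) \<in> parcs G" "(a2, a3) \<notin> parcs G"
    | "(a1, a2) \<in> parcs G" "(a1, a3) \<notin> parcs G" "(a2, a3) \<notin> parcs G"
    | "(a1, a2) \<notin> parcs G" "(a1, a3) \<in> parcs G" "(a2, a3) \<notin> parcs G"
    | "(a1, a2) \<notin> parcs G" "(a1, a3) \<notin> parcs G" "(a2, a3) \<in> parcs G"
    | "(a1, a2) \<notin> parcs G" "(a1, a3) \<notin> parcs G" "(a2, a3) \<notin> parcs G"
    by blast
  then show ?thesis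
  proof cases
    case 1
    with True L have "light_net G a1 a2 a3 b1 b2 b3"
      unfolding light_net_def net_at_def
      by (auto intro: light_local_completion[OF G] dest: local_completion_mono[of _ _ G x])
    then show ?thesis by blast
  next
    case 2
    with light_net_one_new_triangle_edge[OF G L] True show ?thesis by blast
  next
    case 3
    with light_net_one_new_triangle_edge[OF G L''] True sym show ?thesis by blast
  next
    case 4
    with light_net_one_new_triangle_edge[OF G L'] True sym show ?thesis by blast
  next
    case 5
    with light_net_two_new_triangle_edges[OF G L] True show ?thesis by blast
  next
    case 6
    with light_net_two_new_triangle_edges[OF G L''] True sym show ?thesis by blast
  next
    case 7
    with light_net_two_new_triangle_edges[OF G L'] True sym show ?thesis by blast
  next
    case 8
    with light_net_three_new_triangle_edges[OF G L] show ?thesis by blast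
  qed
qed

text \<open>Both absences are carried along together, since a new light net may come from an old
  light claw.\<close>

lemma no_light_claw_or_net_c_steps:
  assumes "c_step\<^sup>*\<^sup>* G H" and "pair_graph G"
    and "\<nexists>c y1 y2 y3. light_claw G c y1 y2 y3"
    and "\<nexists>a1 a2 a3 b1 b2 b3. light_net G a1 a2 a3 b1 b2 b3"
  shows "pair_graph H \<and> (\<nexists>c y1 y2 y3. light_claw H c y1 y2 y3)
    \<and> (\<nexists>a1 a2 a3 b1 b2 b3. light_net H a1 a2 a3 b1 b2 b3)"
  using assms(1)
proof (induction rule: rtranclp_induct)
  case base
  then show ?case using assms by blast
next
  case (step K L)
  then obtain x where L: "L = local_completion K x" and K: "pair_graph K"
    unfolding c_step_def by blast
  show ?case
    using step.IH pair_graph_local_completion[OF K] light_claw_local_completion[OF K]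
      light_net_local_completion[OF K]
    unfolding L by metis
qed

section \<open>Graphs without eligible vertices\<close>

text \<open>Only walks of length at most three from \<open>u\<close> to \<open>v\<close> need to be
  excluded: length two will make the closed neighbourhoods of \<open>u\<close> and \<open>v\<close>
  disjoint, and length three will exclude edges between them. \<open>S\<close> must be nonempty
  because a graph without vertices counts as not connected.\<close>

lemma not_connected_induced_imp_unreachable:
  assumes "pair_wf_digraph K" and "S \<noteq> {}"
    and "\<not> Digraph_Component.connected (with_proj K \<restriction> S)"
  obtains u v where "u \<in> S" "v \<in> S" "u \<noteq> v" "(u, v) \<notin> parcs K"
    "\<And>w. w \<in> S \<Longrightarrow> (u, w) \<in> parcs K \<Longrightarrow> (w, v) \<notin> parcs K"
    "\<And>w w'. w \<in> S \<Longrightarrow> w' \<in> S \<Longrightarrow> (u, w) \<in> parcs K \<Longrightarrow> (w, w') \<in> parcs K \<Longrightarrow> (w', v) \<notin> parcs K"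
proof -
  \<comment> \<open>Connectedness of a digraph means strong connectedness of its symmetric
    closure.\<close>
  let ?M = "mk_symmetric (with_proj K \<restriction> S)"
  have arc: "(p, q) \<in> parcs ?M" if "(p, q) \<in> parcs K" "p \<in> S" "q \<in> S" for p q
    using that by (force simp: parcs_mk_symmetric induce_subgraph_def)
  interpret M: pair_wf_digraph ?M
    by unfold_locales (auto simp: parcs_mk_symmetric induce_subgraph_def)
  from assms obtain u v where uv: "u \<in> S" "v \<in> S" and nr: "\<not> u \<rightarrow>\<^sup>*\<^bsub>?M\<^esub> v"
    unfolding connected_def strongly_connected_def by auto
  have adj: "p \<rightarrow>\<^sup>*\<^bsub>?M\<^esub> q" if "(p, q) \<in> parcs K" "p \<in> S" "q \<in> S" for p q
    using arc[OF that] by (intro M.reachable_adjI) simp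
  show ?thesis
  proof (rule that[OF uv])
    show "u \<noteq> v" using nr uv by auto
    show "(u, v) \<notin> parcs K" using nr uv adj by blast
    show "(w, v) \<notin> parcs K" if "w \<in> S" "(u, w) \<in> parcs K" for w
      using nr uv adj that M.reachable_trans by blast
    show "(w', v) \<notin> parcs K" if "w \<in> S" "w' \<in> S" "(u, w) \<in> parcs K" "(w, w') \<in> parcs K" for w w'
      using nr uv adj that M.reachable_trans by metis
  qed
qed

section \<open>Neighbourhoods of non-eligible vertices\<close>

lemma parcs_BC_completion:
  "(u, v) \<in> parcs (BC_completion G x) \<longleftrightarrow> (u, v) \<in> parcs G \<or>
     ((x, u) \<in> parcs G \<and> (x, v) \<in> parcs G \<and> o_heavy_pair G u v)"
  by (auto simp: BC_completion_def neighborhood_def)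

lemma o_heavy_pair_commute: "pair_graph G \<Longrightarrow> o_heavy_pair G u v \<longleftrightarrow> o_heavy_pair G v u"
  using pair_graph_arcs_sym by (fastforce simp: o_heavy_pair_def)

lemma o_heavy_pair_iff_not_light:
  "u \<in> pverts G \<Longrightarrow> v \<in> pverts G \<Longrightarrow> u \<noteq> v \<Longrightarrow> (u, v) \<notin> parcs G \<Longrightarrow>
    o_heavy_pair G u v \<longleftrightarrow> \<not> light G u v"
  by (auto simp: o_heavy_pair_def light_def)

text \<open>The nonadjacent neighbours \<open>p\<close>, \<open>q\<close> and the lack of
  eligibility make the neighbourhood disconnected in the BC-completion. Having no three independent
  vertices there, it splits into two cliques; the second eligibility condition then fails for every
  \<open>z\<close>.\<close>

lemma not_eligible_neighborhood_cliques:
  assumes G: "pair_graph G" and nc: "\<nexists>c y1 y2 y3. light_claw G c y1 y2 y3"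
    and ne: "\<not> c_eligible G x"
    and pq: "(x, p) \<in> parcs G" "(x, q) \<in> parcs G" "p \<noteq> q" "(p, q) \<notin> parcs G"
  obtains C1 C2 where "neighborhood G x = C1 \<union> C2" "disjoint_cliques (BC_completion G x) C1 C2"
    "p \<in> C1" "C2 \<noteq> {}"
    "\<And>z y1 y2. o_heavy_pair G x z \<Longrightarrow> y1 \<in> C1 \<Longrightarrow> (z, y1) \<in> parcs G \<Longrightarrow> y2 \<in> C2 \<Longrightarrow> (z, y2) \<notin> parcs G"
proof -
  let ?B = "BC_completion G x" and ?N = "neighborhood G x"
  have N: "w \<in> ?N \<longleftrightarrow> (x, w) \<in> parcs G" for w by (simp add: neighborhood_def)
  have NV: "?N \<subseteq> pverts G" using pair_graph_arcs_verts[OF G] by (auto simp: N)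
  have B_sym: "(s, t) \<in> parcs ?B \<longleftrightarrow> (t, s) \<in> parcs ?B" for s t
    using pair_graph_arcs_sym[OF G] o_heavy_pair_commute[OF G] by (metis parcs_BC_completion)
  have "pair_wf_digraph ?B"
    using G by unfold_locales (auto simp: BC_completion_def pair_graph_iff o_heavy_pair_def)
  moreover have "\<not> is_clique G ?N" using pq N unfolding is_clique_def by blast
  then have "\<not> Digraph_Component.connected (with_proj ?B \<restriction> ?N)"
    using ne pair_graph_arcs_verts[OF G pq(1)] by (auto simp: c_eligible_def)
  moreover have "?N \<noteq> {}" using pq N by auto
  ultimately obtain u v where uv: "u \<in> ?N" "v \<in> ?N" "u \<noteq> v" "(u, v) \<notin> parcs ?B"
    and u2: "\<And>w. w \<in> ?N \<Longrightarrow> (u, w) \<in> parcs ?B \<Longrightarrow> (w, v) \<notin> parcs ?B"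
    and u3: "\<And>w w'. w \<in> ?N \<Longrightarrow> w' \<in> ?N \<Longrightarrow> (u, w) \<in> parcs ?B \<Longrightarrow> (w, w') \<in> parcs ?B \<Longrightarrow>
        (w', v) \<notin> parcs ?B"
    using not_connected_induced_imp_unreachable[of ?B ?N] by blast
  \<comment> \<open>Distinct neighbours of \<open>x\<close> not joined in \<open>?B\<close> are
    nonadjacent and not o-heavy, hence light; three such would be the leaves of a light claw at
    \<open>x\<close>.\<close>
  have indep: "(r, s) \<in> parcs ?B \<or> (r, t) \<in> parcs ?B \<or> (s, t) \<in> parcs ?B"
    if "r \<in> ?N" "s \<in> ?N" "t \<in> ?N" "distinct [r, s, t]" for r s t
  proof (rule ccontr)
    assume "\<not> ?thesis"
    moreover have "r \<in> pverts G" "s \<in> pverts G" "t \<in> pverts G" using that NV by auto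
    ultimately have "light_claw G x r s t"
      using that pair_graph_no_loop[OF G] o_heavy_pair_iff_not_light[of _ G]
      unfolding light_claw_def claw_at_def parcs_BC_completion N by auto
    with nc show False by blast
  qed
  \<comment> \<open>These closed neighbourhoods of \<open>u\<close> and \<open>v\<close> in
    \<open>?B\<close> cover \<open>?N\<close> by \<open>indep\<close>; \<open>u2\<close> makes them
    disjoint and \<open>u3\<close> excludes edges between them.\<close>
  define D1 where "D1 = {w \<in> ?N. w = u \<or> (u, w) \<in> parcs ?B}"
  define D2 where "D2 = {w \<in> ?N. w = v \<or> (w, v) \<in> parcs ?B}"
  have D: "?N = D1 \<union> D2"
    unfolding D1_def D2_def using indep[of u v] uv B_sym by fastforce
  have dc: "disjoint_cliques ?B D1 D2"
    unfolding disjoint_cliques_def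
  proof (intro conjI)
    have sub: "D1 \<subseteq> pverts ?B" "D2 \<subseteq> pverts ?B"
      using NV by (auto simp: D1_def D2_def BC_completion_def)
    show disj: "D1 \<inter> D2 = {}" using uv u2 by (auto simp: D1_def D2_def)
    show sep: "\<forall>s\<in>D1. \<forall>t\<in>D2. (s, t) \<notin> parcs ?B"
      using uv u2 u3 unfolding D1_def D2_def by blast
    have "u \<in> D1" "v \<in> D2" using uv by (auto simp: D1_def D2_def)
    \<comment> \<open>Two vertices of \<open>D1\<close> are both nonadjacent to \<open>v\<close> in
      \<open>?B\<close>, so \<open>indep\<close> forces an edge between them.\<close>
    show "is_clique ?B D1"
      unfolding is_clique_def
    proof (intro conjI sub ballI impI)
      fix s t assume "s \<in> D1" "t \<in> D1" "s \<noteq> t"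
      moreover from this have "distinct [s, t, v]" using disj \<open>v \<in> D2\<close> by auto
      ultimately show "(s, t) \<in> parcs ?B" using indep[of s t v] sep \<open>v \<in> D2\<close> D by blast
    qed
    show "is_clique ?B D2"
      unfolding is_clique_def
    proof (intro conjI sub ballI impI)
      fix s t assume "s \<in> D2" "t \<in> D2" "s \<noteq> t"
      moreover from this have "distinct [u, s, t]" using disj \<open>u \<in> D1\<close> by auto
      ultimately show "(s, t) \<in> parcs ?B" using indep[of u s t] sep \<open>u \<in> D1\<close> D by blast
    qed
  qed
  have nz: "(z, y2) \<notin> parcs G"
    if "o_heavy_pair G x z" "y1 \<in> D1" "(z, y1) \<in> parcs G" "y2 \<in> D2" for z y1 y2
    using ne \<open>\<not> is_clique G ?N\<close> D dc that pair_graph_arcs_verts[OF G pq(1)]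
    unfolding c_eligible_def by blast
  have ne': "D1 \<noteq> {}" "D2 \<noteq> {}" using uv by (auto simp: D1_def D2_def)
  \<comment> \<open>The cliques are interchangeable, so the one containing \<open>p\<close> can be
    named first.\<close>
  have "disjoint_cliques ?B D2 D1"
    using dc B_sym unfolding disjoint_cliques_def by blast
  moreover have "p \<in> D1 \<or> p \<in> D2" using pq D N by blast
  ultimately show ?thesis
    using that[of D1 D2] that[of D2 D1] D dc ne' nz by (metis Un_commute)
qed

lemma no_eligible_imp_no_o_heavy_pair:
  assumes G: "pair_graph G" and nc: "\<nexists>c y1 y2 y3. light_claw G c y1 y2 y3"
    and ne: "\<And>x. \<not> c_eligible G x"
  shows "\<not> o_heavy_pair G u v"
proof
  assume h: "o_heavy_pair G u v"
  note sym = pair_graph_arcs_sym[OF G]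
  note irr = pair_graph_no_loop[OF G]
  have uv: "u \<in> pverts G" "v \<in> pverts G" "u \<noteq> v" "(u, v) \<notin> parcs G"
    and deg: "degree G u + degree G v \<ge> card (pverts G)"
    using h by (auto simp: o_heavy_pair_def)
  let ?U = "neighborhood G u" and ?V = "neighborhood G v"
  define A where "A = ?U \<inter> ?V"
  define R where "R = pverts G - insert u (insert v (?U \<union> ?V))"
  have fin: "finite (pverts G)" using G by (simp add: pair_graph_iff)
  have finN: "finite ?U" "finite ?V" using finite_neighborhood[OF G] by auto
  have sub: "insert u (insert v (?U \<union> ?V)) \<subseteq> pverts G"
    using uv pair_graph_arcs_verts[OF G] by (auto simp: neighborhood_def)
  have notin: "u \<notin> ?U \<union> ?V" "v \<notin> ?U \<union> ?V"
    using uv irr sym by (auto simp: neighborhood_def)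
  have "card (pverts G) = card R + card (insert u (insert v (?U \<union> ?V)))"
    unfolding R_def using sub fin by (metis add.commute card_Diff_subset card_mono
        finite_subset le_add_diff_inverse)
  \<comment> \<open>The two extra vertices are \<open>u\<close> and \<open>v\<close>. With the
    degree sum at least \<open>card (pverts G)\<close>, this gives \<open>card A\<close> \<ge>
    \<open>card R\<close> + 2.\<close>
  also have "card (insert u (insert v (?U \<union> ?V))) = card (?U \<union> ?V) + 2"
    using notin uv finN by simp
  finally have "card R < card A"
    using deg card_Un_Int[OF finN] unfolding A_def degree_def by linarith
  define split where "split x C1 C2 \<longleftrightarrow> neighborhood G x = C1 \<union> C2
      \<and> disjoint_cliques (BC_completion G x) C1 C2
      \<and> (\<forall>z y1 y2. o_heavy_pair G x z \<longrightarrow> y1 \<in> C1 \<longrightarrow> (z, y1) \<in> parcs G \<longrightarrow> y2 \<in> C2 \<longrightarrow>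
            (z, y2) \<notin> parcs G)" for x C1 C2
  \<comment> \<open>The pair \<open>u\<close>, \<open>v\<close> is an edge of the BC-completion at
    \<open>x\<close>, so both lie in one clique; any \<open>z\<close> in the other clique is
    adjacent to neither and thus in \<open>R\<close>.\<close>
  have "\<exists>z\<in>R. \<exists>C1 C2. split x C1 C2 \<and> u \<in> C1 \<and> z \<in> C2" if "x \<in> A" for x
  proof -
    have x: "(x, u) \<in> parcs G" "(x, v) \<in> parcs G"
      using that sym by (auto simp: A_def neighborhood_def)
    then obtain C1 C2 where C: "split x C1 C2" "u \<in> C1" "C2 \<noteq> {}"
      using not_eligible_neighborhood_cliques[OF G nc ne x uv(3,4)] unfolding split_def by metis
    then obtain z where z: "z \<in> C2" by blast
    have "(u, v) \<in> parcs (BC_completion G x)"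
      using x h by (auto simp: parcs_BC_completion)
    moreover have "v \<in> C1 \<union> C2" using C x unfolding split_def neighborhood_def by blast
    ultimately have "v \<in> C1" using C unfolding split_def disjoint_cliques_def by blast
    then have "z \<noteq> u" "z \<noteq> v" "(u, z) \<notin> parcs (BC_completion G x)"
      "(v, z) \<notin> parcs (BC_completion G x)" "(x, z) \<in> parcs G"
      using z C unfolding split_def disjoint_cliques_def neighborhood_def by blast+
    then have "z \<in> R"
      using pair_graph_arcs_verts[OF G] unfolding R_def
      by (auto simp: neighborhood_def parcs_BC_completion)
    with C z show ?thesis by blast
  qed
  then obtain f where f: "\<And>x. x \<in> A \<Longrightarrow> f x \<in> R \<and> (\<exists>C1 C2. split x C1 C2 \<and> u \<in> C1 \<and> f x \<in> C2)"
    by metis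
  have "finite R" using fin by (simp add: R_def)
  moreover have "f ` A \<subseteq> R" using f by blast
  \<comment> \<open>Pigeonhole: two common neighbours of \<open>u\<close> and \<open>v\<close>
    receive the same vertex of \<open>R\<close>.\<close>
  ultimately have "\<not> inj_on f A"
    using \<open>card R < card A\<close> card_inj_on_le by (metis not_le)
  then obtain x y where xy: "x \<in> A" "y \<in> A" "x \<noteq> y" "f y = f x" unfolding inj_on_def by metis
  obtain C1 C2 where C: "split x C1 C2" "u \<in> C1" "f x \<in> C2" using f[OF xy(1)] by blast
  have adj: "(u, x) \<in> parcs G" "(u, y) \<in> parcs G" "(v, x) \<in> parcs G" "(v, y) \<in> parcs G"
    using xy by (auto simp: A_def neighborhood_def)
  have yz: "(y, f x) \<in> parcs G"
    using f[OF xy(2)] xy(4) unfolding split_def neighborhood_def by auto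
  \<comment> \<open>If adjacent to \<open>x\<close>, the vertex \<open>y\<close> would lie in one of
    the cliques at \<open>x\<close> and be joined to the other, through \<open>u\<close> or
    \<open>f x\<close>.\<close>
  have nxy: "(x, y) \<notin> parcs G"
  proof
    assume "(x, y) \<in> parcs G"
    then have "y \<in> C1 \<union> C2" using C unfolding split_def neighborhood_def by blast
    moreover have "(u, y) \<in> parcs (BC_completion G x)" "(y, f x) \<in> parcs (BC_completion G x)"
      using adj yz by (auto simp: parcs_BC_completion)
    ultimately show False using C unfolding split_def disjoint_cliques_def by blast
  qed
  obtain D1 D2 where D: "split u D1 D2" "x \<in> D1"
    using not_eligible_neighborhood_cliques[OF G nc ne adj(1,2) xy(3) nxy]
    unfolding split_def by metis
  have "y \<in> D1 \<union> D2" using D adj unfolding split_def neighborhood_def by blast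
  \<comment> \<open>Otherwise \<open>v\<close>, the o-heavy partner of \<open>u\<close>, would be
    adjacent to \<open>x\<close> and \<open>y\<close> in different cliques at
    \<open>u\<close>.\<close>
  moreover have "y \<notin> D2" using D h adj unfolding split_def by blast
  ultimately have "(x, y) \<in> parcs (BC_completion G u)"
    using D xy unfolding split_def disjoint_cliques_def is_clique_def by blast
  then have "o_heavy_pair G x y" using nxy by (auto simp: parcs_BC_completion)
  \<comment> \<open>Now \<open>y\<close> is an o-heavy partner of \<open>x\<close> adjacent to
    \<open>u\<close> in \<open>C1\<close> and to \<open>f x\<close> in \<open>C2\<close>, which
    \<open>split\<close> forbids.\<close>
  then show False using C yz adj sym unfolding split_def by blast
qed

section \<open>Induced claws and nets\<close>

text \<open>Library isomorphisms also carry maps on arcs, tails and heads. For graphs of pairs these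
  are determined by the vertex map, which leaves a bijection; \<open>f\<close> goes from the pattern
  \<open>K\<close> into \<open>G\<close>.\<close>

lemma digraph_iso_induced_iff:
  assumes "parcs K \<subseteq> pverts K \<times> pverts K"
  shows "digraph_iso (with_proj G \<restriction> S) (with_proj K) \<longleftrightarrow>
    (\<exists>f. bij_betw f (pverts K) S \<and>
      (\<forall>i\<in>pverts K. \<forall>j\<in>pverts K. (i, j) \<in> parcs K \<longleftrightarrow> (f i, f j) \<in> parcs G))"
proof
  assume "digraph_iso (with_proj G \<restriction> S) (with_proj K)"
  then obtain h where h: "pre_digraph.digraph_isomorphism (with_proj G \<restriction> S) h"
    and K: "with_proj K = app_iso h (with_proj G \<restriction> S)"
    unfolding digraph_iso_def by blast
  define g where "g = iso_verts h"
  let ?E = "{e \<in> parcs G. fst e \<in> S \<and> snd e \<in> S}"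
  have inj: "inj_on g S"
    using h by (simp add: pre_digraph.digraph_isomorphism_def g_def)
  \<comment> \<open>Comparing the record fields of both sides forces tail and head to be the
    projections.\<close>
  have tail: "iso_tail h = fst" "iso_head h = snd" and verts: "pverts K = g ` S"
    and arcs: "parcs K = iso_arcs h ` ?E"
    using arg_cong[OF K, of tail] arg_cong[OF K, of head] arg_cong[OF K, of verts]
      arg_cong[OF K, of arcs]
    by (simp_all add: app_iso_def g_def induce_subgraph_def)
  have "iso_arcs h e = (g (fst e), g (snd e))" if "e \<in> ?E" for e
    using h that unfolding pre_digraph.digraph_isomorphism_def
    by (cases e) (auto simp: tail g_def induce_subgraph_def intro!: prod_eqI)
  then have arcs': "parcs K = (\<lambda>e. (g (fst e), g (snd e))) ` ?E"
    unfolding arcs by (rule image_cong[OF refl])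
  have "(g s, g t) \<in> parcs K \<longleftrightarrow> (s, t) \<in> parcs G" if "s \<in> S" "t \<in> S" for s t
  proof
    assume "(g s, g t) \<in> parcs K"
    then obtain s' t' where "(s', t') \<in> parcs G" "s' \<in> S" "t' \<in> S" "g s = g s'" "g t = g t'"
      unfolding arcs' by auto
    with that inj show "(s, t) \<in> parcs G" by (metis inj_onD)
  next
    assume "(s, t) \<in> parcs G"
    with that show "(g s, g t) \<in> parcs K" unfolding arcs' by (intro image_eqI[of _ _ "(s, t)"]) auto
  qed
  then have "\<forall>i\<in>pverts K. \<forall>j\<in>pverts K.
      (i, j) \<in> parcs K \<longleftrightarrow> (the_inv_into S g i, the_inv_into S g j) \<in> parcs G"
    using inj verts by (auto simp: the_inv_into_f_f)
  moreover have "bij_betw (the_inv_into S g) (pverts K) S"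
    using inj verts by (intro bij_betw_the_inv_into) (simp add: bij_betw_def)
  ultimately show "\<exists>f. bij_betw f (pverts K) S \<and>
      (\<forall>i\<in>pverts K. \<forall>j\<in>pverts K. (i, j) \<in> parcs K \<longleftrightarrow> (f i, f j) \<in> parcs G)"
    by blast
next
  assume "\<exists>f. bij_betw f (pverts K) S \<and>
      (\<forall>i\<in>pverts K. \<forall>j\<in>pverts K. (i, j) \<in> parcs K \<longleftrightarrow> (f i, f j) \<in> parcs G)"
  then obtain f where f: "bij_betw f (pverts K) S"
    and arc: "\<And>i j. i \<in> pverts K \<Longrightarrow> j \<in> pverts K \<Longrightarrow> (i, j) \<in> parcs K \<longleftrightarrow> (f i, f j) \<in> parcs G"
    by blast
  define g where "g = the_inv_into (pverts K) f"
  have g: "bij_betw g S (pverts K)" unfolding g_def by (rule bij_betw_the_inv_into[OF f])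
  have fg: "f (g s) = s" if "s \<in> S" for s
    using f that unfolding g_def by (metis bij_betw_def f_the_inv_into_f)
  have gS: "g s \<in> pverts K" if "s \<in> S" for s using g that by (auto simp: bij_betw_def)
  have garc: "(g s, g t) \<in> parcs K \<longleftrightarrow> (s, t) \<in> parcs G" if "s \<in> S" "t \<in> S" for s t
    using arc[of "g s" "g t"] fg gS that by simp
  let ?h = "\<lparr>iso_verts = g, iso_arcs = map_prod g g, iso_head = snd, iso_tail = fst\<rparr>"
  let ?E = "{e \<in> parcs G. fst e \<in> S \<and> snd e \<in> S}"
  have inj: "inj_on g S" and img: "g ` S = pverts K" using g by (auto simp: bij_betw_def)
  have "pre_digraph.digraph_isomorphism (with_proj G \<restriction> S) ?h"
    unfolding pre_digraph.digraph_isomorphism_def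
  proof (intro conjI)
    show "wf_digraph (with_proj G \<restriction> S)"
      by unfold_locales (auto simp: induce_subgraph_def)
    show "inj_on (iso_arcs ?h) (arcs (with_proj G \<restriction> S))"
      using inj by (auto simp: inj_on_def induce_subgraph_def)
  qed (use inj in \<open>auto simp: induce_subgraph_def\<close>)
  moreover have "parcs K = map_prod g g ` ?E"
  proof
    show "map_prod g g ` ?E \<subseteq> parcs K" using garc by auto
    show "parcs K \<subseteq> map_prod g g ` ?E"
    proof
      fix e assume e: "e \<in> parcs K"
      then obtain s t where "s \<in> S" "t \<in> S" "e = (g s, g t)"
        using assms img by (cases e) blast
      with e garc show "e \<in> map_prod g g ` ?E" by force
    qed
  qed
  then have "with_proj K = app_iso ?h (with_proj G \<restriction> S)"
    using img by (simp add: app_iso_def with_proj_def induce_subgraph_def)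
  ultimately show "digraph_iso (with_proj G \<restriction> S) (with_proj K)"
    unfolding digraph_iso_def by blast
qed

lemma claw_at_imp_digraph_iso:
  assumes G: "pair_graph G" and c: "claw_at G c y1 y2 y3"
  shows "digraph_iso (with_proj G \<restriction> {c, y1, y2, y3}) (with_proj claw)"
proof -
  let ?f = "\<lambda>i::nat. if i = 0 then c else if i = 1 then y1 else if i = 2 then y2 else y3"
  have "bij_betw ?f (pverts claw) {c, y1, y2, y3}"
    using c by (auto simp: claw_def claw_at_def bij_betw_def inj_on_def)
  moreover have "\<forall>i\<in>pverts claw. \<forall>j\<in>pverts claw. (i, j) \<in> parcs claw \<longleftrightarrow> (?f i, ?f j) \<in> parcs G"
    using c pair_graph_arcs_sym[OF G] pair_graph_no_loop[OF G]
    by (auto simp: claw_def claw_at_def)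
  moreover have "parcs claw \<subseteq> pverts claw \<times> pverts claw" by (auto simp: claw_def)
  ultimately show ?thesis by (subst digraph_iso_induced_iff) blast+
qed

lemma digraph_iso_claw_imp_claw_at:
  assumes "digraph_iso (with_proj G \<restriction> S) (with_proj claw)"
  obtains c y1 y2 y3 where "claw_at G c y1 y2 y3"
proof -
  have "parcs claw \<subseteq> pverts claw \<times> pverts claw" by (auto simp: claw_def)
  from assms[unfolded digraph_iso_induced_iff[OF this]] obtain f
    where "inj_on f (pverts claw)"
      "\<forall>i\<in>pverts claw. \<forall>j\<in>pverts claw. (i, j) \<in> parcs claw \<longleftrightarrow> (f i, f j) \<in> parcs G"
    by (auto simp: bij_betw_def)
  then have "claw_at G (f 0) (f 1) (f 2) (f 3)"
    by (simp add: claw_def claw_at_def)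
  then show ?thesis by (rule that)
qed

lemma net_at_imp_digraph_iso:
  assumes G: "pair_graph G" and n: "net_at G a1 a2 a3 b1 b2 b3"
  shows "digraph_iso (with_proj G \<restriction> {a1, a2, a3, b1, b2, b3}) (with_proj net)"
proof -
  let ?f = "\<lambda>i::nat. if i = 0 then a1 else if i = 1 then a2 else if i = 2 then a3
    else if i = 3 then b1 else if i = 4 then b2 else b3"
  have "distinct [a1, a2, a3, b1, b2, b3]" using n by (simp add: net_at_def)
  \<comment> \<open>The reversed list supplies each inequality in the other orientation for
    rewriting.\<close>
  moreover from this have "distinct [b3, b2, b1, a3, a2, a1]" by auto
  ultimately have "bij_betw ?f (pverts net) {a1, a2, a3, b1, b2, b3}"
    by (simp add: net_def net_on_def bij_betw_def inj_on_def insert_commute)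
  moreover have "\<forall>i\<in>pverts net. \<forall>j\<in>pverts net. (i, j) \<in> parcs net \<longleftrightarrow> (?f i, ?f j) \<in> parcs G"
    using n pair_graph_arcs_sym[OF G] pair_graph_no_loop[OF G]
    by (simp add: net_def net_on_def net_at_def)
  moreover have "parcs net \<subseteq> pverts net \<times> pverts net" by (auto simp: net_def net_on_def)
  ultimately show ?thesis by (subst digraph_iso_induced_iff) blast+
qed

lemma induced_net_imp_net_at:
  assumes d: "distinct [a1, a2, a3, b1, b2, b3]"
    and i: "induced_subgraph (with_proj (net_on a1 a2 a3 b1 b2 b3)) (with_proj G)"
  shows "net_at G a1 a2 a3 b1 b2 b3"
proof -
  let ?S = "{a1, a2, a3, b1, b2, b3}"
  have "parcs (net_on a1 a2 a3 b1 b2 b3) = {e \<in> parcs G. fst e \<in> ?S \<and> snd e \<in> ?S}"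
    using i by (simp add: induced_subgraph_def net_on_def)
  then have "(p, q) \<in> parcs G \<longleftrightarrow> (p, q) \<in> parcs (net_on a1 a2 a3 b1 b2 b3)"
    if "p \<in> ?S" "q \<in> ?S" for p q
    using that by auto
  moreover have "distinct [b3, b2, b1, a3, a2, a1]" using d by auto
  ultimately show ?thesis using d by (simp add: net_at_def net_on_def)
qed

section \<open>From o-heavy conditions to the absence of light claws and nets\<close>

lemma claw_o_heavy_imp_no_light_claw:
  assumes G: "pair_graph G" and "H_o_heavy claw G"
  shows "\<not> light_claw G c y1 y2 y3"
proof
  assume L: "light_claw G c y1 y2 y3"
  then have c: "claw_at G c y1 y2 y3" by (simp add: light_claw_def)
  define S where "S = {c, y1, y2, y3}"
  have "S \<subseteq> pverts G"
    using c pair_graph_arcs_verts[OF G] unfolding S_def by (auto simp: claw_at_def)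
  moreover have "digraph_iso (with_proj G \<restriction> S) (with_proj claw)"
    unfolding S_def by (rule claw_at_imp_digraph_iso[OF G c])
  ultimately obtain u v where uv: "u \<in> S" "v \<in> S" "o_heavy_pair G u v"
    using assms(2) unfolding H_o_heavy_def by blast
  have "\<forall>p\<in>S. \<forall>q\<in>S. p = q \<or> (p, q) \<in> parcs G \<or> light G p q"
    using L pair_graph_arcs_sym[OF G] light_commute[of G]
    unfolding S_def light_claw_def claw_at_def by simp
  with uv show False by (fastforce simp: o_heavy_pair_def light_def)
qed

lemma net_o_heavy_imp_no_light_net:
  assumes G: "pair_graph G" and "H_o_heavy net G"
  shows "\<not> light_net G a1 a2 a3 b1 b2 b3"
proof
  assume L: "light_net G a1 a2 a3 b1 b2 b3"
  then have n: "net_at G a1 a2 a3 b1 b2 b3" by (simp add: light_net_def)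
  define S where "S = {a1, a2, a3, b1, b2, b3}"
  have "S \<subseteq> pverts G"
    using n pair_graph_arcs_verts[OF G] unfolding S_def by (auto simp: net_at_def)
  moreover have "digraph_iso (with_proj G \<restriction> S) (with_proj net)"
    unfolding S_def by (rule net_at_imp_digraph_iso[OF G n])
  ultimately obtain u v where uv: "u \<in> S" "v \<in> S" "o_heavy_pair G u v"
    using assms(2) unfolding H_o_heavy_def by blast
  have "\<forall>p\<in>S. \<forall>q\<in>S. p = q \<or> (p, q) \<in> parcs G \<or> light G p q"
    using L pair_graph_arcs_sym[OF G] light_commute[of G]
    unfolding S_def light_net_def net_at_def by simp
  with uv show False by (fastforce simp: o_heavy_pair_def light_def)
qed

section \<open>Claw-freeness and p-heaviness of the closure\<close>

theorem theorem10:
  fixes G H :: "'a ugraph"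
  assumes "pair_graph G"
    and "family_o_heavy {claw, net} G"
    and "is_c_closure G H"
  shows "H_free claw H \<and> N_p_heavy H"
proof -
  have "H_o_heavy claw G" "H_o_heavy net G" using assms(2) by (auto simp: family_o_heavy_def)
  then have H: "pair_graph H" and nc: "\<nexists>c y1 y2 y3. light_claw H c y1 y2 y3"
    and nn: "\<nexists>a1 a2 a3 b1 b2 b3. light_net H a1 a2 a3 b1 b2 b3"
    using no_light_claw_or_net_c_steps[of G H] claw_o_heavy_imp_no_light_claw[OF assms(1)]
      net_o_heavy_imp_no_light_net[OF assms(1)] assms(1,3)
    unfolding is_c_closure_def by blast+
  have no_heavy: "\<not> o_heavy_pair H u v" for u v
    using no_eligible_imp_no_o_heavy_pair[OF H nc] assms(3) unfolding is_c_closure_def by blast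
  have light: "light H u v"
    if "u \<in> pverts H" "v \<in> pverts H" "u \<noteq> v" "(u, v) \<notin> parcs H" for u v
    using o_heavy_pair_iff_not_light[OF that] no_heavy by blast
  have "H_free claw H"
    unfolding H_free_def
  proof
    assume "\<exists>S\<subseteq>pverts H. digraph_iso (with_proj H \<restriction> S) (with_proj claw)"
    then obtain c y1 y2 y3 where c: "claw_at H c y1 y2 y3"
      using digraph_iso_claw_imp_claw_at by metis
    then have "c \<in> pverts H" "y1 \<in> pverts H" "y2 \<in> pverts H" "y3 \<in> pverts H"
      using pair_graph_arcs_verts[OF H] by (auto simp: claw_at_def)
    with c have "light_claw H c y1 y2 y3"
      unfolding light_claw_def using light by (auto simp: claw_at_def)
    with nc show False by blast
  qed
  moreover have "N_p_heavy H"
    unfolding N_p_heavy_def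
  proof (intro allI impI, rule ccontr)
    fix a1 a2 a3 b1 b2 b3
    assume "distinct [a1, a2, a3, b1, b2, b3]
      \<and> induced_subgraph (with_proj (net_on a1 a2 a3 b1 b2 b3)) (with_proj H)"
      and not_heavy: "\<not> (\<exists>u\<in>{a1, a2, a3}. \<exists>v\<in>{a1, a2, a3}. a_heavy_pair H u v)"
    then have n: "net_at H a1 a2 a3 b1 b2 b3" using induced_net_imp_net_at by metis
    then have "a1 \<in> pverts H" "a2 \<in> pverts H" "a3 \<in> pverts H"
      "b1 \<in> pverts H" "b2 \<in> pverts H" "b3 \<in> pverts H"
      using pair_graph_arcs_verts[OF H] by (auto simp: net_at_def)
    \<comment> \<open>The triangle pairs are light since none is a-heavy; the nonadjacent pairs are
      light since \<open>H\<close> has no o-heavy pair.\<close>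
    moreover have "light H a1 a2" "light H a1 a3" "light H a2 a3"
      using n not_heavy by (auto simp: net_at_def a_heavy_pair_def light_def)
    ultimately have "light_net H a1 a2 a3 b1 b2 b3"
      unfolding light_net_def using n light by (auto simp: net_at_def)
    with nn show False by blast
  qed
  ultimately show ?thesis by blast
qed

end
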